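(* Let the coding system be any one of $\mathsf{K}_1$, $\mathsf{K}_2$, $\mathsf{KV}$. Then $\mathsf{BddSeq}_\omega\equiv_{\sf m}\mathsf{FinHeight}\equiv_{\sf m}\mathsf{FinWidth}$.
   Context: Coding systems. $\mathsf{K}_1$: $\mathtt{Code}=\omega$, and the (partial) realizable functions are the partial computable functions on $\omega$. $\mathsf{K}_2$: $\mathtt{Code}=\omega^\omega$, and the realizable functions are the partial continuous functions $x\mapsto p\ast x$ ($p\in\omega^\omega$), where $\ast$ is application in Kleene's second algebra. $\mathsf{KV}$: $\mathtt{Code}=\omega^\omega$ with the same application, and the realizable functions are the partial computable ones (those $x\mapsto p\ast x$ with $p$ computable). Fix one of them; $\langle\cdot,\cdot\rangle$ is a standard computable tupling on $\mathtt{Code}$. A represented space $X$ is a set $|X|$ with a partial surjection $\delta_X$ from $\mathtt{Code}$ onto $|X|$; $p$ is an $X$-name of $x$ if $\delta_X(p)=x$. A morphism $f\colon X\to Y$ is a function $|X|\to|Y|$ for which some partial realizable function sends every $X$-name of $x$ to a $Y$-name of $f(x)$. In $\mathsf{K}_1$, $n\in\omega$ has name $n$, and $\omega^\omega$ consists of the total computable functions, a name being any index; in $\mathsf{K}_2,\mathsf{KV}$, $n\in\omega$ has name $n0^\infty$, and $\omega^\omega$ consists of all functions, each named by itself. A subobject $A$ of $X$ is a represented space with $|A|\subseteq|X|$ such that some partial realizable function sends every $A$-name of $x\in|A|$ to an $X$-name of $x$. Many-one reducibility: for subobjects $A$ of $X$ and $B$ of $Y$, $A\leq_{\sf m}B$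 if there are a morphism $\varphi\colon X\to Y$ and partial realizable functions $r_-,r_+$ with: (1) for all $x\in|X|$, $x\in|A|\iff\varphi(x)\in|B|$; (2) if $p$ is an $A$-name of $x\in|A|$ then $r_-(p)$ is a $B$-name of $\varphi(x)$; (3) if $p$ is an $X$-name of $x\in|A|$ and $q$ is a $B$-name of $\varphi(x)$ then $r_+(p,q)$ is an $A$-name of $x$. $A\equiv_{\sf m}B$ means $A\leq_{\sf m}B$ and $B\leq_{\sf m}A$. $\mathsf{BddSeq}_\omega$ is the subobject of $\omega^\omega$ with $|\mathsf{BddSeq}_\omega|=\{x:\exists b\,\forall n\; x(n)\leq b\}$; a name of $x\in\mathsf{BddSeq}_\omega$ is a pair $\langle b,p\rangle$ with $p$ an $\omega^\omega$-name of $x$ and $x(n)\leq b$ for all $n$. A partial order on a subset of $\omega$ is coded by the characteristic function in $2^{\omega\times\omega}$ of its order relation, regarded as an element of $\omega^\omega$ via a standard bijection $\omega\times\omega\cong\omega$. If $x\in\omega^\omega$ codes such an order $\leq_x$, the poset is $P_x=\{a\in\omega:a\leq_xa\}$ with $\leq_x$. The height (width) of a poset is the supremum of the cardinalities of its chains (antichains). $\mathsf{FinHeight}$ (respectively $\mathsf{FinWidth}$) is the subobject of $\omega^\omega$ whose underlying set is the set of all $x$ coding a poset $P_x$ of finite height (respectively width); $\langle b,p\rangle$ is a name of $x$ in it iff $p$ is an $\omega^\omega$-name of $x$ and the height (respectively width) of $P_x$ is at most $b\in\omega$. *)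

theory Defs
  imports Main "HOL-Library.Nat_Bijection" "HOL-Library.Extended_Nat"
begin

section \<open>Partial functions given by a graph\<close>

definition pfun_of :: "('a \<Rightarrow> 'b \<Rightarrow> bool) \<Rightarrow> ('a \<rightharpoonup> 'b)" where
  "pfun_of G p = (if \<exists>y. G p y then Some (THE y. G p y) else None)"

text \<open>The graphs used below are single-valued, so that \<^const>\<open>pfun_of\<close> loses nothing.\<close>

lemma pfun_of_eq_Some_iff:
  assumes "\<And>y z. G p y \<Longrightarrow> G p z \<Longrightarrow> y = z"
  shows "pfun_of G p = Some y \<longleftrightarrow> G p y"
proof -
  have "(THE y. G p y) = z" if "G p z" for z
    using that assms by (intro the_equality)
  then show ?thesis
    by (auto simp: pfun_of_def)
qed


section \<open>Partial computable functions and their indices\<close>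

text \<open>
  Kleene's partial recursive functions in unary form: several arguments are passed as one number
  by means of \<^const>\<open>prod_encode\<close>.
\<close>

datatype prog =
    ZeroP
  | SuccP
  | FstP
  | SndP
  | PairP prog prog
  | CompP prog prog
  | PrecP prog prog
  | MuP prog

primrec den :: "prog \<Rightarrow> nat \<rightharpoonup> nat" where
  "den ZeroP n = Some 0"
| "den SuccP n = Some (Suc n)"
| "den FstP n = Some (fst (prod_decode n))"
| "den SndP n = Some (snd (prod_decode n))"
| "den (PairP f g) n =
     Option.bind (den f n) (\<lambda>a. Option.bind (den g n) (\<lambda>b. Some (prod_encode (a, b))))"
| "den (CompP f g) n = Option.bind (den g n) (den f)"
| "den (PrecP f g) n =
     (case prod_decode n of (a, k) \<Rightarrow>
        rec_nat (den f a)
          (\<lambda>i r. Option.bind r (\<lambda>y. den g (prod_encode (a, prod_encode (i, y))))) k)"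
| "den (MuP f) n =
     pfun_of (\<lambda>a k. den f (prod_encode (a, k)) = Some 0 \<and>
                    (\<forall>i<k. \<exists>y. den f (prod_encode (a, i)) = Some (Suc y))) n"

lemma den_MuP_eq_Some_iff:
  "den (MuP f) a = Some k \<longleftrightarrow>
     den f (prod_encode (a, k)) = Some 0 \<and>
     (\<forall>i<k. \<exists>y. den f (prod_encode (a, i)) = Some (Suc y))"
  unfolding den.simps
proof (rule pfun_of_eq_Some_iff, goal_cases)
  case (1 k l)
  then show ?case
    by (cases k l rule: linorder_cases) force+
qed

definition computable :: "(nat \<Rightarrow> nat) \<Rightarrow> bool" where
  "computable x \<longleftrightarrow> (\<exists>c. \<forall>n. den c n = Some (x n))"

primrec index :: "prog \<Rightarrow> nat" where
  "index ZeroP = prod_encode (0, 0)"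
| "index SuccP = prod_encode (1, 0)"
| "index FstP = prod_encode (2, 0)"
| "index SndP = prod_encode (3, 0)"
| "index (PairP f g) = prod_encode (4, prod_encode (index f, index g))"
| "index (CompP f g) = prod_encode (5, prod_encode (index f, index g))"
| "index (PrecP f g) = prod_encode (6, prod_encode (index f, index g))"
| "index (MuP f) = prod_encode (7, index f)"

lemma inj_index: "inj index"
proof (rule injI)
  fix c d assume "index c = index d"
  then show "c = d"
  proof (induction c arbitrary: d)
    case ZeroP then show ?case by (cases d) auto
  next
    case SuccP then show ?case by (cases d) auto
  next
    case FstP then show ?case by (cases d) auto
  next
    case SndP then show ?case by (cases d) auto
  next
    case (PairP f g) then show ?case by (cases d) auto
  next
    case (CompP f g) then show ?case by (cases d) auto
  next
    case (PrecP f g) then show ?case by (cases d) auto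
  next
    case (MuP f) then show ?case by (cases d) auto
  qed
qed

text \<open>Numbers outside the range of \<^const>\<open>index\<close> are indices of the nowhere defined function.\<close>

definition phi :: "nat \<Rightarrow> nat \<rightharpoonup> nat" where
  "phi e = (if e \<in> range index then den (inv index e) else Map.empty)"

lemma phi_index [simp]: "phi (index c) = den c"
  by (simp add: phi_def inv_f_f[OF inj_index])


section \<open>Application in Kleene's second algebra\<close>

text \<open>
  The value of \<open>p \<^bold>* x\<close> at \<open>n\<close> is \<open>p (\<langle>n\<rangle> @ x|k) - 1\<close>
  for the least \<open>k\<close> with \<open>p (\<langle>n\<rangle> @ x|k) > 0\<close>;
  \<open>p \<^bold>* x\<close> is defined iff such a \<open>k\<close> exists for every \<open>n\<close>.
\<close>

definition kapp_graph :: "(nat \<Rightarrow> nat) \<Rightarrow> (nat \<Rightarrow> nat) \<Rightarrow> (nat \<Rightarrow> nat) \<Rightarrow> bool" where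
  "kapp_graph p x y \<longleftrightarrow>
     (\<forall>n. \<exists>k. p (list_encode (n # map x [0..<k])) = Suc (y n) \<and>
              (\<forall>j<k. p (list_encode (n # map x [0..<j])) = 0))"

definition kapp :: "(nat \<Rightarrow> nat) \<Rightarrow> (nat \<Rightarrow> nat) \<rightharpoonup> (nat \<Rightarrow> nat)" where
  "kapp p = pfun_of (kapp_graph p)"

lemma kapp_eq_Some_iff: "kapp p x = Some y \<longleftrightarrow> kapp_graph p x y"
  unfolding kapp_def
proof (rule pfun_of_eq_Some_iff)
  fix y z assume y: "kapp_graph p x y" and z: "kapp_graph p x z"
  show "y = z"
  proof
    fix n
    obtain k where k: "p (list_encode (n # map x [0..<k])) = Suc (y n)"
        "\<forall>j<k. p (list_encode (n # map x [0..<j])) = 0"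
      using y unfolding kapp_graph_def by blast
    obtain l where l: "p (list_encode (n # map x [0..<l])) = Suc (z n)"
        "\<forall>j<l. p (list_encode (n # map x [0..<j])) = 0"
      using z unfolding kapp_graph_def by blast
    have "k = l"
      using k l by (metis linorder_neqE_nat nat.distinct(1))
    then show "y n = z n" using k l by simp
  qed
qed


section \<open>Represented spaces and coding systems\<close>

text \<open>
  A represented space is given by its partial surjection \<open>\<delta>\<close>; the underlying set is
  the range \<open>ran \<delta>\<close>.
\<close>

type_synonym ('c, 'a) rep_space = "'c \<rightharpoonup> 'a"

record 'c coding_system =
  realizable :: "('c \<rightharpoonup> 'c) set"
  tuple :: "'c \<times> 'c \<Rightarrow> 'c"
  omega :: "('c, nat) rep_space"
  baire :: "('c, nat \<Rightarrow> nat) rep_space"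

definition K1 :: "nat coding_system" where
  "K1 = \<lparr> realizable = range den,
          tuple = prod_encode,
          omega = Some,
          baire = pfun_of (\<lambda>e x. \<forall>n. phi e n = Some (x n)) \<rparr>"

definition interleave :: "(nat \<Rightarrow> nat) \<times> (nat \<Rightarrow> nat) \<Rightarrow> nat \<Rightarrow> nat" where
  "interleave pq n = (if even n then fst pq (n div 2) else snd pq (n div 2))"

definition omega_seq :: "(nat \<Rightarrow> nat, nat) rep_space" where
  "omega_seq = pfun_of (\<lambda>p n. p = (\<lambda>i. if i = 0 then n else 0))"

definition K2 :: "(nat \<Rightarrow> nat) coding_system" where
  "K2 = \<lparr> realizable = range kapp,
          tuple = interleave,
          omega = omega_seq,
          baire = Some \<rparr>"

definition KV :: "(nat \<Rightarrow> nat) coding_system" where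
  "KV = \<lparr> realizable = kapp ` {p. computable p},
          tuple = interleave,
          omega = omega_seq,
          baire = Some \<rparr>"

lemma baire_K1_eq_Some_iff: "baire K1 e = Some x \<longleftrightarrow> (\<forall>n. phi e n = Some (x n))"
  unfolding K1_def coding_system.simps
  by (rule pfun_of_eq_Some_iff) (simp add: fun_eq_iff)

lemma ran_baire_K1: "ran (baire K1) = {x. computable x}"
proof -
  have "computable x \<longleftrightarrow> (\<exists>e. baire K1 e = Some x)" for x
  proof
    assume "computable x"
    then obtain c where "\<forall>n. den c n = Some (x n)" by (auto simp: computable_def)
    then have "baire K1 (index c) = Some x" by (simp add: baire_K1_eq_Some_iff)
    then show "\<exists>e. baire K1 e = Some x" ..
  next
    assume "\<exists>e. baire K1 e = Some x"
    then show "computable x"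
      by (force simp: baire_K1_eq_Some_iff computable_def phi_def split: if_splits)
  qed
  then show ?thesis by (auto simp: ran_def)
qed

lemma omega_seq_eq_Some_iff: "omega_seq p = Some n \<longleftrightarrow> p = (\<lambda>i. if i = 0 then n else 0)"
  unfolding omega_seq_def by (rule pfun_of_eq_Some_iff) (metis (full_types))

lemma inj_interleave: "inj interleave"
proof (rule injI)
  fix a b assume eq: "interleave a = interleave b"
  have "fst a n = fst b n" "snd a n = snd b n" for n
    using fun_cong[OF eq, of "2 * n"] fun_cong[OF eq, of "Suc (2 * n)"]
    by (simp_all add: interleave_def)
  then show "a = b" by (simp add: prod_eq_iff fun_eq_iff)
qed

lemma inj_tuple: "inj (tuple K1)" "inj (tuple K2)" "inj (tuple KV)"
  by (simp_all add: K1_def K2_def KV_def inj_prod_encode inj_interleave)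

lemma ran_omega: "ran (omega K1) = UNIV" "ran (omega K2) = UNIV" "ran (omega KV) = UNIV"
  by (auto simp: K1_def K2_def KV_def ran_def omega_seq_eq_Some_iff)


section \<open>Morphisms, subobjects and many-one reducibility\<close>

text \<open>
  A map between underlying sets is represented by a HOL function of which only the values on
  \<open>ran X\<close> matter; that these lie in \<open>ran Y\<close> is enforced by the realizer.
\<close>

definition morphism ::
    "'c coding_system \<Rightarrow> ('c, 'a) rep_space \<Rightarrow> ('c, 'b) rep_space \<Rightarrow> ('a \<Rightarrow> 'b) \<Rightarrow> bool" where
  "morphism K X Y f \<longleftrightarrow>
     (\<exists>r\<in>realizable K. \<forall>p x. X p = Some x \<longrightarrow> (\<exists>q. r p = Some q \<and> Y q = Some (f x)))"

definition subobject :: "'c coding_system \<Rightarrow> ('c, 'a) rep_space \<Rightarrow> ('c, 'a) rep_space \<Rightarrow> bool" where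
  "subobject K A X \<longleftrightarrow> ran A \<subseteq> ran X \<and> morphism K A X (\<lambda>x. x)"

definition many_one_le ::
    "'c coding_system \<Rightarrow> ('c, 'a) rep_space \<Rightarrow> ('c, 'a) rep_space
      \<Rightarrow> ('c, 'b) rep_space \<Rightarrow> ('c, 'b) rep_space \<Rightarrow> bool" where
  "many_one_le K X A Y B \<longleftrightarrow>
     subobject K A X \<and> subobject K B Y \<and>
     (\<exists>\<phi> r\<^sub>m r\<^sub>p. morphism K X Y \<phi> \<and> r\<^sub>m \<in> realizable K \<and> r\<^sub>p \<in> realizable K \<and>
       (\<forall>x\<in>ran X. x \<in> ran A \<longleftrightarrow> \<phi> x \<in> ran B) \<and>
       (\<forall>p x. A p = Some x \<longrightarrow> (\<exists>q. r\<^sub>m p = Some q \<and> B q = Some (\<phi> x))) \<and>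
       (\<forall>p q x. x \<in> ran A \<and> X p = Some x \<and> B q = Some (\<phi> x) \<longrightarrow>
          (\<exists>s. r\<^sub>p (tuple K (p, q)) = Some s \<and> A s = Some x)))"

definition many_one_equiv ::
    "'c coding_system \<Rightarrow> ('c, 'a) rep_space \<Rightarrow> ('c, 'a) rep_space
      \<Rightarrow> ('c, 'b) rep_space \<Rightarrow> ('c, 'b) rep_space \<Rightarrow> bool" where
  "many_one_equiv K X A Y B \<longleftrightarrow> many_one_le K X A Y B \<and> many_one_le K Y B X A"


section \<open>Bounded sequences, posets of finite height and of finite width\<close>

text \<open>
  The names in the spaces below are pairs \<open>\<langle>b, p\<rangle>\<close> of a name of a bound and a name of the
  sequence; the bound, as an element of \<open>\<omega>\<close>, is presented by its \<open>\<omega>\<close>-name.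
\<close>

definition with_bound ::
    "'c coding_system \<Rightarrow> ((nat \<Rightarrow> nat) \<Rightarrow> nat \<Rightarrow> bool) \<Rightarrow> ('c, nat \<Rightarrow> nat) rep_space" where
  "with_bound K Q = pfun_of (\<lambda>s x. \<exists>c b p. s = tuple K (c, p) \<and>
     omega K c = Some b \<and> baire K p = Some x \<and> Q x b)"

lemma with_bound_eq_Some_iff:
  assumes "inj (tuple K)"
  shows "with_bound K Q s = Some x \<longleftrightarrow>
    (\<exists>c b p. s = tuple K (c, p) \<and> omega K c = Some b \<and> baire K p = Some x \<and> Q x b)"
  unfolding with_bound_def
  by (rule pfun_of_eq_Some_iff) (auto simp: inj_eq[OF assms])

lemma ran_with_bound:
  assumes "inj (tuple K)" "ran (omega K) = UNIV"
  shows "ran (with_bound K Q) = {x \<in> ran (baire K). \<exists>b. Q x b}"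
proof -
  have "\<exists>c. omega K c = Some b" for b
    using assms(2) by (auto simp: ran_def set_eq_iff)
  then show ?thesis
    unfolding ran_def with_bound_eq_Some_iff[OF assms(1)] by blast
qed

definition BddSeq :: "'c coding_system \<Rightarrow> ('c, nat \<Rightarrow> nat) rep_space" where
  "BddSeq K = with_bound K (\<lambda>x b. \<forall>n. x n \<le> b)"

definition order_rel :: "(nat \<Rightarrow> nat) \<Rightarrow> nat rel" where
  "order_rel x = {(a, b). x (prod_encode (a, b)) = 1}"

definition poset_carrier :: "(nat \<Rightarrow> nat) \<Rightarrow> nat set" where
  "poset_carrier x = {a. (a, a) \<in> order_rel x}"

definition codes_poset :: "(nat \<Rightarrow> nat) \<Rightarrow> bool" where
  "codes_poset x \<longleftrightarrow> range x \<subseteq> {0, 1} \<and> partial_order_on (poset_carrier x) (order_rel x)"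

definition Antichains :: "'a rel \<Rightarrow> 'a set set" where
  "Antichains r = {A. A \<subseteq> Field r \<and> (\<forall>a\<in>A. \<forall>b\<in>A. (a, b) \<in> r \<longrightarrow> a = b)}"

definition ecard :: "'a set \<Rightarrow> enat" where
  "ecard A = (if finite A then enat (card A) else \<infinity>)"

definition height :: "'a rel \<Rightarrow> enat" where
  "height r = (SUP C\<in>Chains r. ecard C)"

definition width :: "'a rel \<Rightarrow> enat" where
  "width r = (SUP A\<in>Antichains r. ecard A)"

definition FinHeight :: "'c coding_system \<Rightarrow> ('c, nat \<Rightarrow> nat) rep_space" where
  "FinHeight K = with_bound K (\<lambda>x b. codes_poset x \<and> height (order_rel x) \<le> enat b)"

definition FinWidth :: "'c coding_system \<Rightarrow> ('c, nat \<Rightarrow> nat) rep_space" where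
  "FinWidth K = with_bound K (\<lambda>x b. codes_poset x \<and> width (order_rel x) \<le> enat b)"

end

theory Submission
  imports Defs
begin

text \<open>
  All reductions have the same shape: a functional \<open>F\<close> on Baire space such that the very same
  numbers \<open>b\<close> are bounds for \<open>x\<close> and for \<open>F x\<close>.
  The bound in a name can then be copied in both directions, so that \<open>r\<^sub>m\<close> and
  \<open>r\<^sub>p\<close> only rearrange pairs and apply \<open>F\<close> (\<open>many_one_le_with_boundI\<close>).

  Three constructions suffice.  From a sequence \<open>x\<close>, take for every \<open>n\<close> a column of \<open>x n\<close> points
  \<open>\<langle>n, k\<rangle>\<close> with \<open>k < x n\<close>.  If the columns are chains that are pairwise
  incomparable, the height of the poset is the supremum of \<open>x\<close>; if the columns are antichains
  stacked on top of one another, the width is the supremum of \<open>x\<close>.  Conversely, a code \<open>x\<close> of an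
  order is turned into the sequence whose value at \<open>n\<close> is the cardinality of the \<open>n\<close>-th finite set
  if that set is a chain (an antichain), and 0 otherwise.  A chain of more than \<open>b\<close> elements has
  a finite subchain of more than \<open>b\<close> elements, so \<open>b\<close> bounds the sequence iff it bounds the height
  (the width).  That \<open>x\<close> codes a partial order at all is a universal statement about numbers, and as
  soon as a counterexample shows up the sequence switches to the identity and becomes unbounded
  (\<open>stage_le_iff\<close>).  Height and width are compared with each other through bounded sequences, by
  composing the functionals rather than the realizers.

  It remains to realize the functionals.  They are all primitive recursive in \<open>x\<close>.
  In \<open>K1\<close> such a functional is realized without a universal machine: its definition is a
  program with holes, and plugging the program of \<open>x\<close> into the holes is a computable operation on
  indices (\<open>prim_rec_template\<close>).  In \<open>KV\<close>, and hence in \<open>K2\<close>, it has a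
  computable associate: run the definition on a finite prefix of \<open>x\<close> and wait
  until the prefix is long enough to answer all queries (\<open>prim_rec_associate\<close>).
\<close>

section \<open>Functionals that are primitive recursive in an oracle\<close>

text \<open>
  The clauses mirror the constructors of \<^typ>\<open>prog\<close>, with \<open>query\<close> for the oracle and without
  unbounded search, so that every functional is total and can be written as a HOL function.
  A function without oracle appears as a functional that is constant in its first argument.
\<close>

inductive prim_rec :: "((nat \<Rightarrow> nat) \<Rightarrow> nat \<Rightarrow> nat) \<Rightarrow> bool" where
  query: "prim_rec (\<lambda>x n. x n)"
| zero: "prim_rec (\<lambda>x n. 0)"
| Suc: "prim_rec (\<lambda>x n. Suc n)"
| first: "prim_rec (\<lambda>x n. fst (prod_decode n))"
| second: "prim_rec (\<lambda>x n. snd (prod_decode n))"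
| pair: "prim_rec F \<Longrightarrow> prim_rec G \<Longrightarrow> prim_rec (\<lambda>x n. prod_encode (F x n, G x n))"
| comp: "prim_rec F \<Longrightarrow> prim_rec G \<Longrightarrow> prim_rec (\<lambda>x n. F x (G x n))"
| prec: "prim_rec F \<Longrightarrow> prim_rec G \<Longrightarrow>
    prim_rec (\<lambda>x n. rec_nat (F x (fst (prod_decode n)))
      (\<lambda>i y. G x (prod_encode (fst (prod_decode n), prod_encode (i, y)))) (snd (prod_decode n)))"

text \<open>
  Each query to \<open>G x\<close> is answered by computing \<open>G\<close>.  This is how reductions are composed.
\<close>

lemma prim_rec_subst:
  assumes "prim_rec F" "prim_rec G"
  shows "prim_rec (\<lambda>x. F (G x))"
  using assms(1)
proof induction
  case query
  then show ?case using assms(2) by simp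
next
  case (pair F H)
  show ?case by (rule prim_rec.pair[OF pair.IH])
next
  case (comp F H)
  show ?case by (rule prim_rec.comp[OF comp.IH])
next
  case (prec F H)
  show ?case by (rule prim_rec.prec[OF prec.IH])
qed (rule prim_rec.zero prim_rec.Suc prim_rec.first prim_rec.second)+

text \<open>
  The rules collected here are meant for \<open>intro\<close>: they decompose a term syntactically, and bound
  variables are encoded into the numerical argument as they are met.
\<close>

named_theorems prim_rec_intros

lemma prim_rec_id [prim_rec_intros]: "prim_rec (\<lambda>x n. n)"
  using pair[OF first second] by simp

lemma prim_rec_const [prim_rec_intros]: "prim_rec (\<lambda>x n. c)"
proof (induction c)
  case (Suc c)
  show ?case by (rule comp[OF prim_rec.Suc Suc])
qed (rule zero)

lemmas prim_rec_query [prim_rec_intros] = comp[OF query]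
lemmas prim_rec_Suc [prim_rec_intros] = comp[OF prim_rec.Suc]
lemmas prim_rec_fst [prim_rec_intros] = comp[OF first]
lemmas prim_rec_snd [prim_rec_intros] = comp[OF second]
lemmas prim_rec_pair [prim_rec_intros] = pair

lemma prim_rec_rec_nat [prim_rec_intros]:
  assumes "prim_rec A" "prim_rec C"
    and "prim_rec (\<lambda>x m. B x (fst (prod_decode (snd (prod_decode m))))
           (snd (prod_decode (snd (prod_decode m)))) (fst (prod_decode m)))"
  shows "prim_rec (\<lambda>x n. rec_nat (A x n) (\<lambda>i y. B x i y n) (C x n))"
  using comp[OF prec[OF assms(1,3)] pair[OF prim_rec_id assms(2)]] by simp

lemma prim_rec_pred [prim_rec_intros]:
  assumes "prim_rec A"
  shows "prim_rec (\<lambda>x n. A x n - 1)"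
proof -
  have eq: "k - 1 = rec_nat 0 (\<lambda>i y. i) k" for k :: nat by (cases k) auto
  show ?thesis unfolding eq by (intro prim_rec_intros assms)
qed

lemma prim_rec_add [prim_rec_intros]:
  assumes "prim_rec A" "prim_rec B"
  shows "prim_rec (\<lambda>x n. A x n + B x n)"
proof -
  have eq: "j + k = rec_nat j (\<lambda>i y. Suc y) k" for j k :: nat by (induction k) auto
  show ?thesis unfolding eq by (intro prim_rec_intros assms)
qed

lemma prim_rec_diff:
  assumes "prim_rec A" "prim_rec B"
  shows "prim_rec (\<lambda>x n. A x n - B x n)"
proof -
  have eq: "j - k = rec_nat j (\<lambda>i y. y - 1) k" for j k :: nat by (induction k) auto
  show ?thesis unfolding eq[of "A x n" "B x n" for x n] by (intro prim_rec_intros assms)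
qed

lemma prim_rec_div2 [prim_rec_intros]:
  assumes "prim_rec A"
  shows "prim_rec (\<lambda>x n. A x n div 2)"
proof -
  \<comment> \<open>Starting from \<open>\<langle>0, 0\<rangle>\<close>, whose code is 0, \<open>?h k\<close> codes \<open>\<langle>k div 2, Suc k div 2\<rangle>\<close>.\<close>
  let ?h = "rec_nat 0 (\<lambda>i y. prod_encode (snd (prod_decode y), Suc (fst (prod_decode y))))"
  have "?h k = prod_encode (k div 2, Suc k div 2)" for k
  proof (induction k)
    case 0
    show ?case by (simp add: prod_encode_def)
  qed simp
  then have eq: "k div 2 = fst (prod_decode (?h k))" for k by simp
  show ?thesis unfolding eq by (intro prim_rec_intros assms)
qed

lemma prim_rec_sum [prim_rec_intros]:
  assumes "prim_rec B" and "prim_rec (\<lambda>x m. A x (snd (prod_decode m)) (fst (prod_decode m)))"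
  shows "prim_rec (\<lambda>x n. \<Sum>i<B x n. A x i n)"
proof -
  have eq: "(\<Sum>i<k. f i) = rec_nat 0 (\<lambda>i y. y + f i) k" for f :: "nat \<Rightarrow> nat" and k
    by (induction k) auto
  show ?thesis unfolding eq
    by (intro prim_rec_intros assms(1)
        comp[OF assms(2), of "\<lambda>x m. prod_encode (G x m, H x m)" for G H, simplified])
qed

definition decidable :: "((nat \<Rightarrow> nat) \<Rightarrow> nat \<Rightarrow> bool) \<Rightarrow> bool" where
  "decidable P \<longleftrightarrow> prim_rec (\<lambda>x n. of_bool (P x n))"

lemma prim_rec_of_bool [prim_rec_intros]:
  "decidable P \<Longrightarrow> prim_rec (\<lambda>x n. of_bool (P x n))"
  by (simp add: decidable_def)

lemma prim_rec_if [prim_rec_intros]: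
  assumes "decidable P" "prim_rec A" "prim_rec B"
  shows "prim_rec (\<lambda>x n. if P x n then A x n else B x n)"
proof -
  have eq: "(if p then j else k) = rec_nat k (\<lambda>_ _. j) (of_bool p)" for p and j k :: nat
    by simp
  show ?thesis unfolding eq by (intro prim_rec_intros assms comp[OF assms(2)])
qed

lemma decidable_not [prim_rec_intros]:
  assumes "decidable P"
  shows "decidable (\<lambda>x n. \<not> P x n)"
proof -
  have eq: "of_bool (\<not> p) = (if p then 0 else 1 :: nat)" for p by simp
  show ?thesis unfolding decidable_def eq by (intro prim_rec_intros assms)
qed

lemma decidable_conj [prim_rec_intros]:
  assumes "decidable P" "decidable Q"
  shows "decidable (\<lambda>x n. P x n \<and> Q x n)"
proof -
  have eq: "of_bool (p \<and> q) = (if p then of_bool q else 0 :: nat)" for p q by simp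
  show ?thesis unfolding decidable_def eq by (intro prim_rec_intros assms)
qed

lemma decidable_disj [prim_rec_intros]:
  assumes "decidable P" "decidable Q"
  shows "decidable (\<lambda>x n. P x n \<or> Q x n)"
  using decidable_not[OF decidable_conj[OF assms[THEN decidable_not]]] by simp

lemma decidable_imp [prim_rec_intros]:
  assumes "decidable P" "decidable Q"
  shows "decidable (\<lambda>x n. P x n \<longrightarrow> Q x n)"
  unfolding imp_conv_disj by (intro prim_rec_intros assms)

lemma decidable_le [prim_rec_intros]:
  assumes "prim_rec A" "prim_rec B"
  shows "decidable (\<lambda>x n. A x n \<le> B x n)"
proof -
  have eq: "of_bool (j \<le> k) = rec_nat 1 (\<lambda>_ _. 0) (j - k)" for j k :: nat
    by (cases "j - k") auto
  show ?thesis unfolding decidable_def eq by (intro prim_rec_intros prim_rec_diff assms)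
qed

lemma decidable_less [prim_rec_intros]:
  assumes "prim_rec A" "prim_rec B"
  shows "decidable (\<lambda>x n. A x n < B x n)"
  unfolding not_le[symmetric] by (intro prim_rec_intros assms)

lemma decidable_eq [prim_rec_intros]:
  assumes "prim_rec A" "prim_rec B"
  shows "decidable (\<lambda>x n. A x n = B x n)"
  unfolding eq_iff by (intro prim_rec_intros assms)

lemma decidable_all [prim_rec_intros]:
  assumes "prim_rec B" and "decidable (\<lambda>x m. P x (snd (prod_decode m)) (fst (prod_decode m)))"
  shows "decidable (\<lambda>x n. \<forall>i<B x n. P x i n)"
proof -
  have eq: "(\<forall>i<k. p i) \<longleftrightarrow> (\<Sum>i<k. of_bool (\<not> p i)) = (0::nat)" for p and k :: nat
    by auto
  show ?thesis unfolding eq by (intro prim_rec_intros assms)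
qed

lemma decidable_even [prim_rec_intros]:
  assumes "prim_rec A"
  shows "decidable (\<lambda>x n. even (A x n))"
proof -
  have eq: "even k \<longleftrightarrow> k = k div 2 + k div 2" for k :: nat by presburger
  show ?thesis unfolding eq by (intro prim_rec_intros assms)
qed

lemma decidable_set_decode [prim_rec_intros]:
  assumes "prim_rec A" "prim_rec B"
  shows "decidable (\<lambda>x n. A x n \<in> set_decode (B x n))"
proof -
  \<comment> \<open>Halving repeatedly avoids the exponential function.\<close>
  have div: "k div 2 ^ a = rec_nat k (\<lambda>_ y. y div 2) a" for k a :: nat
    by (induction a) (simp, simp only: power_Suc2 div_mult2_eq old.nat.rec)
  show ?thesis unfolding set_decode_def mem_Collect_eq div by (intro prim_rec_intros assms)
qed

lemma set_decode_less: "a \<in> set_decode n \<Longrightarrow> a < n"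
proof -
  assume "a \<in> set_decode n"
  then have "2 ^ a \<le> n" by (metis set_decode_def mem_Collect_eq div_less even_zero not_le)
  then show "a < n" using less_exp[of a] by linarith
qed

lemma prim_rec_card_set_decode [prim_rec_intros]:
  assumes "prim_rec A"
  shows "prim_rec (\<lambda>x n. card (set_decode (A x n)))"
proof -
  have "{a. a < k \<and> a \<in> set_decode k} = set_decode k" for k
    using set_decode_less by auto
  then have eq: "card (set_decode k) = (\<Sum>a<k. of_bool (a \<in> set_decode k))" for k
    by (simp add: of_bool_def sum.If_cases Int_def)
  show ?thesis unfolding eq by (intro prim_rec_intros assms comp[OF assms])
qed

section \<open>Realizers for primitive recursive functionals\<close>

lemma const_prog: "\<exists>c. \<forall>n. den c n = Some k"
proof (induction k)
  case 0
  show ?case by (rule exI[of _ ZeroP]) simp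
next
  case (Suc k)
  then obtain c where "\<forall>n. den c n = Some k" ..
  then show ?case by (intro exI[of _ "CompP SuccP c"]) simp
qed

text \<open>
  A realizer in \<^const>\<open>K1\<close> receives an index of the oracle.  The map \<open>t\<close> puts the oracle program
  \<open>c\<close> at every place where \<open>F\<close> queries the oracle.
\<close>

definition template_for :: "((nat \<Rightarrow> nat) \<Rightarrow> nat \<Rightarrow> nat) \<Rightarrow> (prog \<Rightarrow> prog) \<Rightarrow> bool" where
  "template_for F t \<longleftrightarrow>
     (\<exists>d. \<forall>c. den d (index c) = Some (index (t c))) \<and>
     (\<forall>c x n. den c = Some \<circ> x \<longrightarrow> den (t c) n = Some (F x n))"

lemma index_const: "\<exists>d. \<forall>c. den d (index c) = Some (index c')"
  using const_prog by blast

text \<open>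
  The index of a compound program is obtained from the indices of its parts by pairing, hence by
  a program.
\<close>

lemma index_binary:
  assumes "\<exists>d. \<forall>c. den d (index c) = Some (index (s c))"
    and "\<exists>d. \<forall>c. den d (index c) = Some (index (t c))"
    and "\<And>a b. index (op a b) = prod_encode (k, prod_encode (index a, index b))"
  shows "\<exists>d. \<forall>c. den d (index c) = Some (index (op (s c) (t c)))"
proof -
  obtain ds dt dk where "\<forall>c. den ds (index c) = Some (index (s c))"
    "\<forall>c. den dt (index c) = Some (index (t c))" "\<forall>n. den dk n = Some k"
    using assms(1,2) const_prog by metis
  then show ?thesis
    by (intro exI[of _ "PairP dk (PairP ds dt)"]) (simp add: assms(3))
qed

lemma prim_rec_template: "prim_rec F \<Longrightarrow> \<exists>t. template_for F t"
proof (induction rule: prim_rec.induct)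
  case query
  have "\<exists>d. \<forall>c. den d (index c) = Some (index c)"
    by (rule exI[of _ "PairP FstP SndP"]) simp
  then show ?case by (intro exI[of _ "\<lambda>c. c"]) (simp add: template_for_def)
next
  case zero
  show ?case by (intro exI[of _ "\<lambda>c. ZeroP"]) (simp only: template_for_def index_const den.simps simp_thms)
next
  case Suc
  show ?case by (intro exI[of _ "\<lambda>c. SuccP"]) (simp only: template_for_def index_const den.simps simp_thms)
next
  case first
  show ?case by (intro exI[of _ "\<lambda>c. FstP"]) (simp only: template_for_def index_const den.simps simp_thms)
next
  case second
  show ?case by (intro exI[of _ "\<lambda>c. SndP"]) (simp only: template_for_def index_const den.simps simp_thms)
next
  case (pair F G)
  then obtain s t where "template_for F s" "template_for G t" by blast
  then show ?case
    by (intro exI[of _ "\<lambda>c. PairP (s c) (t c)"])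
      (simp add: template_for_def index_binary[OF _ _ index.simps(5)] del: index.simps)
next
  case (comp F G)
  then obtain s t where "template_for F s" "template_for G t" by blast
  then show ?case
    by (intro exI[of _ "\<lambda>c. CompP (s c) (t c)"])
      (simp add: template_for_def index_binary[OF _ _ index.simps(6)] del: index.simps)
next
  case (prec F G)
  then obtain s t where st: "template_for F s" "template_for G t" by blast
  have "den (PrecP (s c) (t c)) n = Some (rec_nat (F x (fst (prod_decode n)))
      (\<lambda>i y. G x (prod_encode (fst (prod_decode n), prod_encode (i, y)))) (snd (prod_decode n)))"
    if "den c = Some \<circ> x" for c x n
  proof -
    obtain a k where n: "prod_decode n = (a, k)" by force
    have "rec_nat (den (s c) a) (\<lambda>i r. Option.bind r (\<lambda>y. den (t c) (prod_encode (a, prod_encode (i, y))))) k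
      = Some (rec_nat (F x a) (\<lambda>i y. G x (prod_encode (a, prod_encode (i, y)))) k)"
      using st that by (induction k) (auto simp: template_for_def)
    then show ?thesis by (simp add: n)
  qed
  moreover have "\<exists>d. \<forall>c. den d (index c) = Some (index (PrecP (s c) (t c)))"
    using st by (intro index_binary[OF _ _ index.simps(7)]) (simp_all add: template_for_def)
  ultimately show ?case
    unfolding template_for_def by (intro exI[of _ "\<lambda>c. PrecP (s c) (t c)"]) blast
qed

text \<open>
  The template of an oracle-free functional may be filled with any total program.
\<close>

lemma prim_rec_computable:
  assumes "prim_rec (\<lambda>x. f)"
  shows "computable f"
proof -
  obtain t where "template_for (\<lambda>x. f) t" using prim_rec_template[OF assms] ..
  moreover have "den ZeroP = Some \<circ> (\<lambda>n. 0)" by auto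
  ultimately have "\<forall>n. den (t ZeroP) n = Some (f n)" unfolding template_for_def by blast
  then show ?thesis unfolding computable_def by blast
qed

definition prefix :: "(nat \<Rightarrow> nat) \<Rightarrow> nat \<Rightarrow> nat" where
  "prefix x k = list_encode (map x [0..<k])"

text \<open>
  \<open>P\<close> computes \<open>F x\<close> from prefixes of \<open>x\<close>, answering \<open>Suc v\<close> for the value \<open>v\<close> and 0 for a prefix
  that is too short.  Asking for success on all sufficiently long prefixes, rather than on one,
  lets finitely many successes be combined on a common prefix.
\<close>

definition approximates :: "(nat \<Rightarrow> nat) \<Rightarrow> ((nat \<Rightarrow> nat) \<Rightarrow> nat \<Rightarrow> nat) \<Rightarrow> bool" where
  "approximates P F \<longleftrightarrow> (\<forall>x n.
     (\<forall>k v. P (prod_encode (prefix x k, n)) = Suc v \<longrightarrow> v = F x n) \<and>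
     (\<forall>\<^sub>F k in sequentially. P (prod_encode (prefix x k, n)) = Suc (F x n)))"

text \<open>
  The \<open>n\<close>-th tail of a list is coded by iterating \<open>\<lambda>y. snd (prod_decode (y - 1))\<close>; since
  \<open>prod_decode 0 = (0, 0)\<close>, the code 0 of the empty list is a fixed point, so that running off the
  end is recognised by the value 0.
\<close>

definition lookup :: "nat \<Rightarrow> nat \<Rightarrow> nat" where
  "lookup s n = (let r = rec_nat s (\<lambda>_ y. snd (prod_decode (y - 1))) n in
     if r = 0 then 0 else Suc (fst (prod_decode (r - 1))))"

lemma lookup_list_encode:
  "lookup (list_encode xs) n = (if n < length xs then Suc (xs ! n) else 0)"
proof -
  have tl: "snd (prod_decode (list_encode ys - 1)) = list_encode (tl ys)" for ys
  proof (cases ys)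
    case Nil
    have "prod_decode 0 = (0, 0)"
      using prod_encode_inverse[of "(0, 0)"] by (simp add: prod_encode_def)
    then show ?thesis by (simp add: Nil)
  qed simp
  have "rec_nat (list_encode xs) (\<lambda>_ y. snd (prod_decode (y - 1))) n = list_encode (drop n xs)"
    by (induction n) (simp_all only: rec_nat_0_imp old.nat.rec tl drop0 drop_Suc tl_drop)
  then show ?thesis
    by (cases "n < length xs") (auto simp: lookup_def Let_def Cons_nth_drop_Suc[symmetric])
qed

lemma prim_rec_lookup:
  assumes "prim_rec A" "prim_rec B"
  shows "prim_rec (\<lambda>x n. lookup (A x n) (B x n))"
  unfolding lookup_def Let_def by (intro prim_rec_intros assms)

text \<open>
  The definition of \<open>F\<close> is evaluated strictly: the result is 0 as soon as some
  subcomputation is 0, and only an oracle query past the end of the prefix gives 0 in the first place.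
\<close>

lemma prim_rec_approximated:
  "prim_rec F \<Longrightarrow> \<exists>P. prim_rec (\<lambda>_. P) \<and> approximates P F"
proof (induction rule: prim_rec.induct)
  case query
  have look: "lookup (prefix x k) n = (if n < k then Suc (x n) else 0)" for x k n
    by (simp add: prefix_def lookup_list_encode)
  have "approximates (\<lambda>m. lookup (fst (prod_decode m)) (snd (prod_decode m))) (\<lambda>x n. x n)"
    using eventually_gt_at_top by (auto simp: approximates_def look elim: eventually_mono)
  moreover have "prim_rec (\<lambda>_ m. lookup (fst (prod_decode m)) (snd (prod_decode m)))"
    by (intro prim_rec_lookup prim_rec_intros)
  ultimately show ?case by (intro exI conjI)
next
  case zero
  show ?case
    by (rule exI[of _ "\<lambda>_. Suc 0"]) (auto simp: approximates_def intro: prim_rec_intros)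
next
  case Suc
  show ?case
    by (rule exI[of _ "\<lambda>m. Suc (Suc (snd (prod_decode m)))"])
      (auto simp: approximates_def intro!: prim_rec_intros)
next
  case first
  show ?case
    by (rule exI[of _ "\<lambda>m. Suc (fst (prod_decode (snd (prod_decode m))))"])
      (auto simp: approximates_def intro!: prim_rec_intros)
next
  case second
  show ?case
    by (rule exI[of _ "\<lambda>m. Suc (snd (prod_decode (snd (prod_decode m))))"])
      (auto simp: approximates_def intro!: prim_rec_intros)
next
  case (pair F G)
  then obtain P Q where PQ: "prim_rec (\<lambda>_. P)" "approximates P F"
    "prim_rec (\<lambda>_. Q)" "approximates Q G" by blast
  let ?R = "\<lambda>m. if P m = 0 \<or> Q m = 0 then 0 else Suc (prod_encode (P m - 1, Q m - 1))"
  have "prim_rec (\<lambda>_. ?R)" by (intro prim_rec_intros PQ)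
  moreover have "approximates ?R (\<lambda>x n. prod_encode (F x n, G x n))"
    unfolding approximates_def
  proof (intro allI conjI impI)
    fix x n k v assume "?R (prod_encode (prefix x k, n)) = Suc v"
    then show "v = prod_encode (F x n, G x n)"
      using PQ(2,4) by (auto simp: approximates_def gr0_conv_Suc split: if_splits)
  next
    fix x n
    have "\<forall>\<^sub>F k in sequentially. P (prod_encode (prefix x k, n)) = Suc (F x n)"
      "\<forall>\<^sub>F k in sequentially. Q (prod_encode (prefix x k, n)) = Suc (G x n)"
      using PQ(2,4) by (auto simp: approximates_def)
    then show "\<forall>\<^sub>F k in sequentially. ?R (prod_encode (prefix x k, n)) = Suc (prod_encode (F x n, G x n))"
      by eventually_elim simp
  qed
  ultimately show ?case by blast
next
  case (comp F G)
  then obtain P Q where PQ: "prim_rec (\<lambda>_. P)" "approximates P F"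
    "prim_rec (\<lambda>_. Q)" "approximates Q G" by blast
  let ?R = "\<lambda>m. if Q m = 0 then 0 else P (prod_encode (fst (prod_decode m), Q m - 1))"
  have "prim_rec (\<lambda>_. ?R)" by (intro prim_rec_intros PQ prim_rec.comp[OF PQ(1)])
  moreover have "approximates ?R (\<lambda>x n. F x (G x n))"
    unfolding approximates_def
  proof (intro allI conjI impI)
    fix x n k v assume "?R (prod_encode (prefix x k, n)) = Suc v"
    then show "v = F x (G x n)"
      using PQ(2,4) by (auto simp: approximates_def gr0_conv_Suc split: if_splits)
  next
    fix x n
    have "\<forall>\<^sub>F k in sequentially. P (prod_encode (prefix x k, G x n)) = Suc (F x (G x n))"
      "\<forall>\<^sub>F k in sequentially. Q (prod_encode (prefix x k, n)) = Suc (G x n)"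
      using PQ(2,4) by (auto simp: approximates_def)
    then show "\<forall>\<^sub>F k in sequentially. ?R (prod_encode (prefix x k, n)) = Suc (F x (G x n))"
      by eventually_elim simp
  qed
  ultimately show ?case by blast
next
  case (prec F G)
  then obtain P Q where PQ: "prim_rec (\<lambda>_. P)" "approximates P F"
    "prim_rec (\<lambda>_. Q)" "approximates Q G" by blast
  define S where "S = (\<lambda>s a. rec_nat (P (prod_encode (s, a)))
    (\<lambda>i y. if y = 0 then 0 else Q (prod_encode (s, prod_encode (a, prod_encode (i, y - 1))))))"
  let ?R = "\<lambda>m. S (fst (prod_decode m)) (fst (prod_decode (snd (prod_decode m))))
    (snd (prod_decode (snd (prod_decode m))))"
  let ?T = "\<lambda>x a. rec_nat (F x a) (\<lambda>i y. G x (prod_encode (a, prod_encode (i, y))))"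
  have "prim_rec (\<lambda>_. ?R)"
    unfolding S_def by (intro prim_rec_intros comp[OF PQ(1)] comp[OF PQ(3)])
  moreover have sound: "S (prefix x k) a l = Suc v \<Longrightarrow> v = ?T x a l" for x k a l v
  proof (induction l arbitrary: v)
    case 0
    then show ?case using PQ(2) by (simp add: S_def approximates_def)
  next
    case (Suc l)
    then obtain w where w: "S (prefix x k) a l = Suc w"
      by (auto simp: S_def gr0_conv_Suc split: if_splits)
    then have "w = ?T x a l" by (rule Suc.IH)
    then show ?case using Suc.prems w PQ(4) by (simp add: S_def approximates_def)
  qed
  moreover have "\<forall>\<^sub>F k in sequentially. S (prefix x k) a l = Suc (?T x a l)" for x a l
  proof (induction l)
    case 0
    then show ?case using PQ(2) by (simp add: S_def approximates_def)
  next
    case (Suc l)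
    have "\<forall>\<^sub>F k in sequentially. Q (prod_encode (prefix x k, prod_encode (a, prod_encode (l, ?T x a l))))
      = Suc (?T x a (Suc l))"
      using PQ(4) by (simp add: approximates_def)
    with Suc show ?case by eventually_elim (simp add: S_def)
  qed
  ultimately show ?case by (intro exI[of _ ?R]) (simp add: approximates_def)
qed

text \<open>
  In Kleene's application the first nonzero answer counts.  Soundness of the approximation
  makes it correct, whichever prefix it comes from.
\<close>

lemma prim_rec_associate:
  assumes "prim_rec F"
  shows "\<exists>p. computable p \<and> (\<forall>x. kapp p x = Some (F x))"
proof -
  obtain P where P: "prim_rec (\<lambda>_. P)" "approximates P F"
    using prim_rec_approximated[OF assms] by blast
  define p where "p m = P (prod_encode (snd (prod_decode (m - 1)), fst (prod_decode (m - 1))))" for m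
  have "prim_rec (\<lambda>_. p)" unfolding p_def by (intro prim_rec_intros comp[OF P(1)])
  then have "computable p" by (rule prim_rec_computable)
  moreover have "kapp_graph p x (F x)" for x
    unfolding kapp_graph_def
  proof
    fix n
    have p: "p (list_encode (n # map x [0..<k])) = P (prod_encode (prefix x k, n))" for k
      by (simp add: p_def prefix_def)
    have "\<forall>\<^sub>F k in sequentially. P (prod_encode (prefix x k, n)) = Suc (F x n)"
      using P(2) by (simp add: approximates_def)
    then obtain l where "P (prod_encode (prefix x l, n)) = Suc (F x n)"
      using eventually_happens'[OF sequentially_bot] by blast
    then have ex: "\<exists>k. P (prod_encode (prefix x k, n)) \<noteq> 0" by (intro exI[of _ l]) simp
    define k where "k = (LEAST k. P (prod_encode (prefix x k, n)) \<noteq> 0)"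
    have "P (prod_encode (prefix x k, n)) \<noteq> 0" unfolding k_def by (rule LeastI_ex[OF ex])
    then obtain v where "P (prod_encode (prefix x k, n)) = Suc v" by (auto simp: gr0_conv_Suc)
    with P(2) have "P (prod_encode (prefix x k, n)) = Suc (F x n)"
      unfolding approximates_def by metis
    moreover have "\<forall>j<k. P (prod_encode (prefix x j, n)) = 0"
      using not_less_Least unfolding k_def by blast
    ultimately show "\<exists>k. p (list_encode (n # map x [0..<k])) = Suc (F x n) \<and>
        (\<forall>j<k. p (list_encode (n # map x [0..<j])) = 0)"
      unfolding p by blast
  qed
  ultimately show ?thesis by (auto simp: kapp_eq_Some_iff)
qed

section \<open>Reductions that preserve bounds\<close>

text \<open>
  Because \<open>bounds\<close> is an equivalence for each single \<open>b\<close>, \<open>r\<^sub>m\<close> and \<open>r\<^sub>p\<close> keep the name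
  \<open>c\<close> of the bound; \<open>r\<^sub>p\<close> combines the bound for \<open>F x\<close> with the original name of \<open>x\<close>.
\<close>

lemma many_one_le_with_boundI:
  assumes inj: "inj (tuple K)" and omega: "ran (omega K) = UNIV"
    and proj: "r\<^sub>0 \<in> realizable K" "\<And>c p. r\<^sub>0 (tuple K (c, p)) = Some p"
    and apply_F: "r\<^sub>F \<in> realizable K"
      "\<And>p x. baire K p = Some x \<Longrightarrow> \<exists>q. r\<^sub>F p = Some q \<and> baire K q = Some (F x)"
    and apply_F_snd: "r\<^sub>m \<in> realizable K"
      "\<And>c p x. baire K p = Some x \<Longrightarrow>
         \<exists>q. r\<^sub>m (tuple K (c, p)) = Some (tuple K (c, q)) \<and> baire K q = Some (F x)"
    and rearrange: "r\<^sub>p \<in> realizable K"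
      "\<And>p c q. r\<^sub>p (tuple K (p, tuple K (c, q))) = Some (tuple K (c, p))"
    and bounds: "\<And>x b. Q x b \<longleftrightarrow> R (F x) b"
  shows "many_one_le K (baire K) (with_bound K Q) (baire K) (with_bound K R)"
proof -
  note wb = with_bound_eq_Some_iff[OF inj] and rwb = ran_with_bound[OF inj omega]
  have sub: "subobject K (with_bound K Q) (baire K)" for Q
    using proj by (auto simp: subobject_def morphism_def wb rwb intro!: bexI[of _ r\<^sub>0])
  have mor: "morphism K (baire K) (baire K) F"
    using apply_F unfolding morphism_def by blast
  have "x \<in> ran (with_bound K Q) \<longleftrightarrow> F x \<in> ran (with_bound K R)" if x: "x \<in> ran (baire K)" for x
  proof -
    have "F x \<in> ran (baire K)" using x apply_F(2) by (auto simp: ran_def)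
    then show ?thesis using x by (simp add: rwb bounds)
  qed
  moreover have "\<exists>q. r\<^sub>m s = Some q \<and> with_bound K R q = Some (F x)"
    if "with_bound K Q s = Some x" for s x
    using that apply_F_snd(2) unfolding wb bounds by metis
  moreover have "\<exists>s. r\<^sub>p (tuple K (p, q)) = Some s \<and> with_bound K Q s = Some x"
    if "baire K p = Some x" "with_bound K R q = Some (F x)" for p q x
    using that rearrange(2) unfolding wb bounds by metis
  ultimately show ?thesis
    unfolding many_one_le_def using sub mor apply_F_snd(1) rearrange(1) by blast
qed

lemma many_one_le_K1:
  assumes "prim_rec F" "\<And>x b. Q x b \<longleftrightarrow> R (F x) b"
  shows "many_one_le K1 (baire K1) (with_bound K1 Q) (baire K1) (with_bound K1 R)"
proof -
  obtain t d where d: "\<And>c. den d (index c) = Some (index (t c))"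
    and t: "\<And>c x n. den c = Some \<circ> x \<Longrightarrow> den (t c) n = Some (F x n)"
    using prim_rec_template[OF assms(1)] unfolding template_for_def by metis
  have F: "\<exists>q. den d e = Some q \<and> baire K1 q = Some (F x)" if e: "baire K1 e = Some x" for e x
  proof -
    have phi: "phi e n = Some (x n)" for n using e by (simp add: baire_K1_eq_Some_iff)
    have "e \<in> range index"
      by (rule ccontr) (use phi[of 0] in \<open>simp add: phi_def\<close>)
    then obtain c where c: "e = index c" by blast
    have "den c = Some \<circ> x" using phi c by auto
    then show ?thesis using t d c by (simp add: baire_K1_eq_Some_iff)
  qed
  have K1: "realizable K1 = range den" "tuple K1 = prod_encode" by (simp_all add: K1_def)
  show ?thesis
  proof (rule many_one_le_with_boundI[where r\<^sub>0 = "den SndP" and r\<^sub>F = "den d"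
        and r\<^sub>m = "den (PairP FstP (CompP d SndP))"
        and r\<^sub>p = "den (PairP (CompP FstP SndP) FstP)"])
    fix c e x assume "baire K1 e = Some x"
    from F[OF this] show "\<exists>q. den (PairP FstP (CompP d SndP)) (tuple K1 (c, e)) = Some (tuple K1 (c, q)) \<and>
        baire K1 q = Some (F x)"
      by (auto simp: K1)
  qed (auto simp: K1 inj_prod_encode ran_omega assms(2) F)
qed

lemma many_one_le_interleave:
  assumes "tuple K = interleave" "baire K = Some" "ran (omega K) = UNIV"
    and realizable: "\<And>p. computable p \<Longrightarrow> kapp p \<in> realizable K"
    and F: "prim_rec F" "\<And>x b. Q x b \<longleftrightarrow> R (F x) b"
  shows "many_one_le K (baire K) (with_bound K Q) (baire K) (with_bound K R)"
proof -
  have real: "\<exists>r\<in>realizable K. \<forall>x. r x = Some (G x)" if "prim_rec G" for G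
    using prim_rec_associate[OF that] realizable by blast
  have double: "2 * k = k + k" for k :: nat by simp
  \<comment> \<open>On interleaved pairs the rearrangements are functionals themselves: \<open>?S\<close> is the second
    projection, \<open>?M\<close> sends \<open>\<langle>c, p\<rangle>\<close> to \<open>\<langle>c, F p\<rangle>\<close>, and \<open>?R\<close> sends \<open>\<langle>p, \<langle>c, q\<rangle>\<rangle>\<close> to \<open>\<langle>c, p\<rangle>\<close>.\<close>
  let ?S = "\<lambda>s n. s (Suc (2 * n))"
  let ?M = "\<lambda>s n. if even n then s n else F (?S s) (n div 2)"
  let ?R = "\<lambda>s n. if even n then s (Suc (2 * n)) else s (2 * (n div 2))"
  have S: "prim_rec ?S" unfolding double by (intro prim_rec_intros)
  have M: "prim_rec ?M"
    by (intro prim_rec_intros prim_rec.comp[OF prim_rec_subst[OF F(1) S]])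
  have R: "prim_rec ?R" unfolding double by (intro prim_rec_intros)
  obtain r\<^sub>0 where r0: "r\<^sub>0 \<in> realizable K" "\<And>x. r\<^sub>0 x = Some (?S x)"
    using real[OF S] by blast
  obtain r\<^sub>F where rF: "r\<^sub>F \<in> realizable K" "\<And>x. r\<^sub>F x = Some (F x)"
    using real[OF F(1)] by blast
  obtain r\<^sub>m where rm: "r\<^sub>m \<in> realizable K" "\<And>x. r\<^sub>m x = Some (?M x)"
    using real[OF M] by blast
  obtain r\<^sub>p where rp: "r\<^sub>p \<in> realizable K" "\<And>x. r\<^sub>p x = Some (?R x)"
    using real[OF R] by blast
  note r = r0 rF rm rp
  show ?thesis
  proof (rule many_one_le_with_boundI[of K r\<^sub>0 r\<^sub>F F r\<^sub>m r\<^sub>p])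
    show "r\<^sub>0 (tuple K (c, p)) = Some p" for c p
      by (simp add: r assms(1) interleave_def)
    show "\<exists>q. r\<^sub>m (tuple K (c, p)) = Some (tuple K (c, q)) \<and> baire K q = Some (F x)"
      if "baire K p = Some x" for c p x
      using that by (auto simp: r assms(1,2) interleave_def fun_eq_iff)
    show "r\<^sub>p (tuple K (p, tuple K (c, q))) = Some (tuple K (c, p))" for p c q
      by (auto simp: r assms(1) interleave_def fun_eq_iff elim!: oddE)
  qed (use r assms inj_interleave in simp_all)
qed

section \<open>Bounded sequences versus finite height and width\<close>

text \<open>
  An infinite member of a family that is closed under subsets has finite subsets of every
  cardinality in the family, so that only finite members have to be tested against \<open>b\<close>.
\<close>

lemma Sup_ecard_le_iff:
  assumes "\<And>C D. C \<in> \<F> \<Longrightarrow> D \<subseteq> C \<Longrightarrow> D \<in> \<F>"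
  shows "(SUP C\<in>\<F>. ecard C) \<le> enat b \<longleftrightarrow> (\<forall>C\<in>\<F>. finite C \<longrightarrow> card C \<le> b)"
proof
  assume "(SUP C\<in>\<F>. ecard C) \<le> enat b"
  then have "ecard C \<le> enat b" if "C \<in> \<F>" for C using that by (simp add: SUP_le_iff)
  then show "\<forall>C\<in>\<F>. finite C \<longrightarrow> card C \<le> b" by (force simp: ecard_def)
next
  assume *: "\<forall>C\<in>\<F>. finite C \<longrightarrow> card C \<le> b"
  have "ecard C \<le> enat b" if C: "C \<in> \<F>" for C
  proof (cases "finite C")
    case False
    then obtain D where D: "D \<subseteq> C" "finite D" "card D = Suc b"
      using infinite_arbitrarily_large by blast
    then have "card D \<le> b" using assms[OF C] * by blast
    then show ?thesis using D by simp
  qed (use * C in \<open>simp add: ecard_def\<close>)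
  then show "(SUP C\<in>\<F>. ecard C) \<le> enat b" by (rule SUP_least)
qed

lemma height_le_iff:
  "height r \<le> enat b \<longleftrightarrow> (\<forall>C\<in>Chains r. finite C \<longrightarrow> card C \<le> b)"
  unfolding height_def by (rule Sup_ecard_le_iff) (auto simp: Chains_def)

lemma width_le_iff:
  "width r \<le> enat b \<longleftrightarrow> (\<forall>A\<in>Antichains r. finite A \<longrightarrow> card A \<le> b)"
  unfolding width_def by (rule Sup_ecard_le_iff) (auto simp: Antichains_def)

definition column :: "(nat \<Rightarrow> nat) \<Rightarrow> nat \<Rightarrow> nat set" where
  "column x n = (\<lambda>k. prod_encode (n, k)) ` {..<x n}"

lemma mem_column: "a \<in> column x n \<longleftrightarrow> fst (prod_decode a) = n \<and> snd (prod_decode a) < x n"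
proof -
  obtain i k where "a = prod_encode (i, k)" by (metis prod_decode_inverse surj_pair)
  then show ?thesis by (auto simp: column_def)
qed

lemma finite_column [simp]: "finite (column x n)" and card_column [simp]: "card (column x n) = x n"
  by (auto simp: column_def card_image inj_on_def)

lemma card_le_columns:
  assumes "\<And>n. column x n \<in> \<F>" and "\<And>C. C \<in> \<F> \<Longrightarrow> \<exists>n. C \<subseteq> column x n"
  shows "(\<forall>C\<in>\<F>. finite C \<longrightarrow> card C \<le> b) \<longleftrightarrow> (\<forall>n. x n \<le> b)"
proof (intro iffI ballI impI allI)
  fix n assume "\<forall>C\<in>\<F>. finite C \<longrightarrow> card C \<le> b"
  then show "x n \<le> b" using assms(1)[of n] by force
next
  fix C assume b: "\<forall>n. x n \<le> b" and "C \<in> \<F>"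
  then obtain n where "C \<subseteq> column x n" using assms(2) by blast
  then have "card C \<le> x n" using card_mono[OF finite_column] by (metis card_column)
  then show "card C \<le> b" using b le_trans by blast
qed

definition disjoint_chains :: "(nat \<Rightarrow> nat) \<Rightarrow> nat \<Rightarrow> nat" where
  "disjoint_chains x m = of_bool
     (case prod_decode m of (a, b) \<Rightarrow>
        fst (prod_decode a) = fst (prod_decode b) \<and> snd (prod_decode a) \<le> snd (prod_decode b) \<and>
        snd (prod_decode b) < x (fst (prod_decode b)))"

definition stacked_antichains :: "(nat \<Rightarrow> nat) \<Rightarrow> nat \<Rightarrow> nat" where
  "stacked_antichains x m = of_bool
     (case prod_decode m of (a, b) \<Rightarrow>
        snd (prod_decode a) < x (fst (prod_decode a)) \<and>
        snd (prod_decode b) < x (fst (prod_decode b)) \<and>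
        (a = b \<or> fst (prod_decode a) < fst (prod_decode b)))"

lemma prim_rec_disjoint_chains: "prim_rec disjoint_chains"
proof -
  have "prim_rec (\<lambda>x m. disjoint_chains x m)"
    unfolding disjoint_chains_def case_prod_beta by (intro prim_rec_intros)
  then show ?thesis by simp
qed

lemma prim_rec_stacked_antichains: "prim_rec stacked_antichains"
proof -
  have "prim_rec (\<lambda>x m. stacked_antichains x m)"
    unfolding stacked_antichains_def case_prod_beta by (intro prim_rec_intros)
  then show ?thesis by simp
qed

lemma order_rel_disjoint_chains:
  "(a, b) \<in> order_rel (disjoint_chains x) \<longleftrightarrow>
     fst (prod_decode a) = fst (prod_decode b) \<and> snd (prod_decode a) \<le> snd (prod_decode b) \<and>
     snd (prod_decode b) < x (fst (prod_decode b))"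
  by (simp add: order_rel_def disjoint_chains_def)

lemma order_rel_stacked_antichains:
  "(a, b) \<in> order_rel (stacked_antichains x) \<longleftrightarrow>
     snd (prod_decode a) < x (fst (prod_decode a)) \<and>
     snd (prod_decode b) < x (fst (prod_decode b)) \<and>
     (a = b \<or> fst (prod_decode a) < fst (prod_decode b))"
  by (simp add: order_rel_def stacked_antichains_def)

definition poset_at :: "(nat \<Rightarrow> nat) \<Rightarrow> nat \<Rightarrow> nat \<Rightarrow> nat \<Rightarrow> bool" where
  "poset_at x a b c \<longleftrightarrow> x a \<le> 1 \<and>
     ((a, b) \<in> order_rel x \<longrightarrow> (a, a) \<in> order_rel x \<and> (b, b) \<in> order_rel x) \<and>
     ((a, b) \<in> order_rel x \<and> (b, a) \<in> order_rel x \<longrightarrow> a = b) \<and>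
     ((a, b) \<in> order_rel x \<and> (b, c) \<in> order_rel x \<longrightarrow> (a, c) \<in> order_rel x)"

text \<open>
  Being a code of a poset is refutable: every failure is witnessed by three numbers.
\<close>

lemma codes_poset_iff: "codes_poset x \<longleftrightarrow> (\<forall>a b c. poset_at x a b c)"
proof
  assume "codes_poset x"
  then have x: "range x \<subseteq> {0, 1}" and po: "order_rel x \<subseteq> poset_carrier x \<times> poset_carrier x"
    "antisym (order_rel x)" "trans (order_rel x)"
    by (auto simp: codes_poset_def partial_order_on_def preorder_on_def)
  show "\<forall>a b c. poset_at x a b c"
  proof (intro allI)
    fix a b c
    have "x a \<in> {0, 1}" using x by blast
    moreover have "(a, b) \<in> order_rel x \<longrightarrow> (a, a) \<in> order_rel x \<and> (b, b) \<in> order_rel x"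
      using po(1) by (auto simp: poset_carrier_def)
    moreover have "(a, b) \<in> order_rel x \<and> (b, a) \<in> order_rel x \<longrightarrow> a = b"
      using antisymD[OF po(2)] by blast
    moreover have "(a, b) \<in> order_rel x \<and> (b, c) \<in> order_rel x \<longrightarrow> (a, c) \<in> order_rel x"
      using transD[OF po(3)] by blast
    ultimately show "poset_at x a b c" unfolding poset_at_def by auto
  qed
next
  assume "\<forall>a b c. poset_at x a b c"
  then have at: "poset_at x a b c" for a b c by blast
  have "x a = 0 \<or> x a = 1" for a using at[of a a a] unfolding poset_at_def by linarith
  then have "range x \<subseteq> {0, 1}" by (simp add: image_subset_iff)
  moreover have "antisym (order_rel x)"
  proof (rule antisymI)
    fix a b
    show "(a, b) \<in> order_rel x \<Longrightarrow> (b, a) \<in> order_rel x \<Longrightarrow> a = b"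
      using at[of a b] unfolding poset_at_def by blast
  qed
  moreover have "trans (order_rel x)"
  proof (rule transI)
    fix a b c
    show "(a, b) \<in> order_rel x \<Longrightarrow> (b, c) \<in> order_rel x \<Longrightarrow> (a, c) \<in> order_rel x"
      using at[of a b c] unfolding poset_at_def by blast
  qed
  moreover have "order_rel x \<subseteq> poset_carrier x \<times> poset_carrier x"
  proof (rule subrelI)
    fix a b
    show "(a, b) \<in> order_rel x \<Longrightarrow> (a, b) \<in> poset_carrier x \<times> poset_carrier x"
      using at[of a b] unfolding poset_at_def poset_carrier_def by blast
  qed
  ultimately show "codes_poset x"
    by (auto simp: codes_poset_def partial_order_on_def preorder_on_def refl_on_def
        poset_carrier_def)
qed

lemma codes_posetI:
  assumes "\<And>m. x m \<le> 1"
    and "\<And>a b. (a, b) \<in> order_rel x \<Longrightarrow> (a, a) \<in> order_rel x \<and> (b, b) \<in> order_rel x"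
    and "\<And>a b. (a, b) \<in> order_rel x \<Longrightarrow> (b, a) \<in> order_rel x \<Longrightarrow> a = b"
    and "\<And>a b c. (a, b) \<in> order_rel x \<Longrightarrow> (b, c) \<in> order_rel x \<Longrightarrow> (a, c) \<in> order_rel x"
  shows "codes_poset x"
  unfolding codes_poset_iff poset_at_def using assms by (intro allI conjI impI) blast+

lemma codes_poset_disjoint_chains: "codes_poset (disjoint_chains x)"
proof (rule codes_posetI)
  fix a b
  assume "(a, b) \<in> order_rel (disjoint_chains x)" "(b, a) \<in> order_rel (disjoint_chains x)"
  then have "prod_decode a = prod_decode b"
    by (intro prod_eqI) (auto simp: order_rel_disjoint_chains)
  then show "a = b" by simp
next
  show "disjoint_chains x m \<le> 1" for m by (simp add: disjoint_chains_def)
qed (auto simp: order_rel_disjoint_chains)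

lemma codes_poset_stacked_antichains: "codes_poset (stacked_antichains x)"
proof (rule codes_posetI)
  show "stacked_antichains x m \<le> 1" for m by (simp add: stacked_antichains_def)
qed (auto simp: order_rel_stacked_antichains)

lemma height_disjoint_chains:
  "height (order_rel (disjoint_chains x)) \<le> enat b \<longleftrightarrow> (\<forall>n. x n \<le> b)"
  unfolding height_le_iff
proof (rule card_le_columns)
  show "column x n \<in> Chains (order_rel (disjoint_chains x))" for n
    by (auto simp: Chains_def order_rel_disjoint_chains mem_column)
  show "\<exists>n. C \<subseteq> column x n" if C: "C \<in> Chains (order_rel (disjoint_chains x))" for C
  proof (cases "C = {}")
    case False
    then obtain a where "a \<in> C" by blast
    then have "C \<subseteq> column x (fst (prod_decode a))"
      using C by (fastforce simp: Chains_def order_rel_disjoint_chains mem_column)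
    then show ?thesis ..
  qed simp
qed

lemma width_stacked_antichains:
  "width (order_rel (stacked_antichains x)) \<le> enat b \<longleftrightarrow> (\<forall>n. x n \<le> b)"
  unfolding width_le_iff
proof (rule card_le_columns)
  show "column x n \<in> Antichains (order_rel (stacked_antichains x))" for n
    by (auto simp: Antichains_def order_rel_stacked_antichains mem_column intro!: FieldI1[of a a for a])
  show "\<exists>n. A \<subseteq> column x n" if A: "A \<in> Antichains (order_rel (stacked_antichains x))" for A
  proof (cases "A = {}")
    case False
    then obtain a where a: "a \<in> A" by blast
    have mem: "snd (prod_decode b) < x (fst (prod_decode b))" if "b \<in> A" for b
      using A that by (auto simp: Antichains_def Field_def order_rel_stacked_antichains)
    have "fst (prod_decode b) = fst (prod_decode a)" if b: "b \<in> A" for b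
    proof (cases "fst (prod_decode b)" "fst (prod_decode a)" rule: linorder_cases)
      case less
      then have "(b, a) \<in> order_rel (stacked_antichains x)"
        using mem a b by (simp add: order_rel_stacked_antichains)
      then show ?thesis using A a b by (auto simp: Antichains_def)
    next
      case greater
      then have "(a, b) \<in> order_rel (stacked_antichains x)"
        using mem a b by (simp add: order_rel_stacked_antichains)
      then show ?thesis using A a b by (auto simp: Antichains_def)
    qed
    then have "A \<subseteq> column x (fst (prod_decode a))" using mem by (force simp: mem_column)
    then show ?thesis ..
  qed simp
qed

text \<open>
  Only triples below \<open>n\<close> are inspected at stage \<open>n\<close>, so a violation affects all later stages.
  The value \<open>n\<close> is then returned for all of them, which makes the sequence unbounded.
\<close>

definition stage :: "((nat \<Rightarrow> nat) \<Rightarrow> nat \<Rightarrow> bool) \<Rightarrow> (nat \<Rightarrow> nat) \<Rightarrow> nat \<Rightarrow> nat" where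
  "stage T x n =
     (if \<forall>t<n. poset_at x (fst (prod_decode t)) (fst (prod_decode (snd (prod_decode t))))
                 (snd (prod_decode (snd (prod_decode t))))
      then if T x n then card (set_decode n) else 0
      else n)"

lemma decidable_order_rel [prim_rec_intros]:
  assumes "prim_rec A" "prim_rec B"
  shows "decidable (\<lambda>x n. (A x n, B x n) \<in> order_rel x)"
  unfolding order_rel_def mem_Collect_eq prod.case by (intro prim_rec_intros assms)

lemma prim_rec_stage:
  assumes "decidable T"
  shows "prim_rec (stage T)"
proof -
  have "prim_rec (\<lambda>x n. stage T x n)"
    unfolding stage_def poset_at_def by (intro prim_rec_intros assms)
  then show ?thesis by simp
qed

text \<open>
  For a poset the stages enumerate the cardinalities of the finite members of \<open>\<F>\<close> (and 0), since
  every finite set is decoded from some \<open>n\<close>.  If \<open>x\<close> codes no poset, then \<open>T\<close> may be arbitrary: a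
  stage beyond both the violation and \<open>b\<close> exceeds \<open>b\<close>.
\<close>

lemma stage_le_iff:
  assumes T: "\<And>n. codes_poset x \<Longrightarrow> T x n \<longleftrightarrow> set_decode n \<in> \<F>"
  shows "(\<forall>n. stage T x n \<le> b) \<longleftrightarrow> codes_poset x \<and> (\<forall>C\<in>\<F>. finite C \<longrightarrow> card C \<le> b)"
proof (cases "codes_poset x")
  case True
  then have stage: "stage T x n = (if set_decode n \<in> \<F> then card (set_decode n) else 0)" for n
    using T by (simp add: stage_def codes_poset_iff)
  have "(\<forall>n. stage T x n \<le> b) \<longleftrightarrow> (\<forall>C\<in>\<F>. finite C \<longrightarrow> card C \<le> b)"
  proof
    assume *: "\<forall>n. stage T x n \<le> b"
    show "\<forall>C\<in>\<F>. finite C \<longrightarrow> card C \<le> b"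
    proof (intro ballI impI)
      fix C assume "C \<in> \<F>" "finite C"
      then show "card C \<le> b" using *[rule_format, of "set_encode C"] by (simp add: stage)
    qed
  qed (simp add: stage)
  then show ?thesis using True by simp
next
  case False
  then obtain a b' c where v: "\<not> poset_at x a b' c" by (auto simp: codes_poset_iff)
  define t where "t = prod_encode (a, prod_encode (b', c))"
  have "t < Suc (max t b)" by simp
  moreover have "\<not> poset_at x (fst (prod_decode t)) (fst (prod_decode (snd (prod_decode t))))
      (snd (prod_decode (snd (prod_decode t))))"
    using v by (simp add: t_def)
  ultimately have "stage T x (Suc (max t b)) = Suc (max t b)"
    unfolding stage_def by (meson if_not_P)
  then have "\<not> stage T x (Suc (max t b)) \<le> b" by simp
  then show ?thesis using False by blast
qed

text \<open>
  Every element of \<open>set_decode n\<close> is less than \<open>n\<close>, which provides the bounds on the quantifiers.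
\<close>

definition chain_code :: "(nat \<Rightarrow> nat) \<Rightarrow> nat \<Rightarrow> bool" where
  "chain_code x n \<longleftrightarrow> (\<forall>a<n. \<forall>b<n. a \<in> set_decode n \<and> b \<in> set_decode n \<longrightarrow>
     (a, b) \<in> order_rel x \<or> (b, a) \<in> order_rel x)"

definition antichain_code :: "(nat \<Rightarrow> nat) \<Rightarrow> nat \<Rightarrow> bool" where
  "antichain_code x n \<longleftrightarrow> (\<forall>a<n. \<forall>b<n. a \<in> set_decode n \<and> b \<in> set_decode n \<longrightarrow>
     (a, a) \<in> order_rel x \<and> ((a, b) \<in> order_rel x \<longrightarrow> a = b))"

lemma decidable_chain_code: "decidable chain_code"
proof -
  have "decidable (\<lambda>x n. chain_code x n)"
    unfolding chain_code_def by (intro prim_rec_intros)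
  then show ?thesis by simp
qed

lemma decidable_antichain_code: "decidable antichain_code"
proof -
  have "decidable (\<lambda>x n. antichain_code x n)"
    unfolding antichain_code_def by (intro prim_rec_intros)
  then show ?thesis by simp
qed

lemma chain_code_iff: "chain_code x n \<longleftrightarrow> set_decode n \<in> Chains (order_rel x)"
  unfolding chain_code_def Chains_def using set_decode_less by blast

text \<open>
  The definition of antichains requires membership in the field of the order, which is an unbounded
  existential statement.  In a poset it reduces to reflexivity at the given element.
\<close>

lemma antichain_code_iff:
  assumes "codes_poset x"
  shows "antichain_code x n \<longleftrightarrow> set_decode n \<in> Antichains (order_rel x)"
proof -
  have "order_rel x \<subseteq> poset_carrier x \<times> poset_carrier x"
    using assms by (auto simp: codes_poset_def partial_order_on_def preorder_on_def)
  then have "a \<in> Field (order_rel x) \<longleftrightarrow> (a, a) \<in> order_rel x" for a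
    by (auto simp: Field_def poset_carrier_def)
  then show ?thesis
    unfolding antichain_code_def Antichains_def using set_decode_less by blast
qed

section \<open>The equivalences\<close>

lemma many_one_le_all:
  assumes "prim_rec F" "\<And>x b. Q x b \<longleftrightarrow> R (F x) b"
  shows "many_one_le K1 (baire K1) (with_bound K1 Q) (baire K1) (with_bound K1 R)"
    "many_one_le K2 (baire K2) (with_bound K2 Q) (baire K2) (with_bound K2 R)"
    "many_one_le KV (baire KV) (with_bound KV Q) (baire KV) (with_bound KV R)"
proof -
  show "many_one_le K1 (baire K1) (with_bound K1 Q) (baire K1) (with_bound K1 R)"
    using assms by (rule many_one_le_K1)
  show "many_one_le K2 (baire K2) (with_bound K2 Q) (baire K2) (with_bound K2 R)"
    by (rule many_one_le_interleave[where F = F and Q = Q and R = R, OF _ _ ran_omega(2) _ assms]) (auto simp: K2_def)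
  show "many_one_le KV (baire KV) (with_bound KV Q) (baire KV) (with_bound KV R)"
    by (rule many_one_le_interleave[where F = F and Q = Q and R = R, OF _ _ ran_omega(3) _ assms]) (auto simp: KV_def)
qed

theorem mainTheorem3:
  shows "(many_one_equiv K1 (baire K1) (BddSeq K1) (baire K1) (FinHeight K1) \<and>
          many_one_equiv K1 (baire K1) (FinHeight K1) (baire K1) (FinWidth K1)) \<and>
         (many_one_equiv K2 (baire K2) (BddSeq K2) (baire K2) (FinHeight K2) \<and>
          many_one_equiv K2 (baire K2) (FinHeight K2) (baire K2) (FinWidth K2)) \<and>
         (many_one_equiv KV (baire KV) (BddSeq KV) (baire KV) (FinHeight KV) \<and>
          many_one_equiv KV (baire KV) (FinHeight KV) (baire KV) (FinWidth KV))"
proof -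
  let ?B = "\<lambda>x b. \<forall>n. x n \<le> b"
  let ?H = "\<lambda>x b. codes_poset x \<and> height (order_rel x) \<le> enat b"
  let ?W = "\<lambda>x b. codes_poset x \<and> width (order_rel x) \<le> enat b"
  have BH: "?B x b \<longleftrightarrow> ?H (disjoint_chains x) b" for x b
    by (simp add: codes_poset_disjoint_chains height_disjoint_chains)
  have BW: "?B x b \<longleftrightarrow> ?W (stacked_antichains x) b" for x b
    by (simp add: codes_poset_stacked_antichains width_stacked_antichains)
  have HB: "?H x b \<longleftrightarrow> ?B (stage chain_code x) b" for x b
    unfolding height_le_iff by (rule stage_le_iff[symmetric]) (rule chain_code_iff)
  have WB: "?W x b \<longleftrightarrow> ?B (stage antichain_code x) b" for x b
    unfolding width_le_iff by (rule stage_le_iff[symmetric]) (rule antichain_code_iff)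
  have HW: "?H x b \<longleftrightarrow> ?W (stacked_antichains (stage chain_code x)) b" for x b
    using HB BW by (rule trans)
  have WH: "?W x b \<longleftrightarrow> ?H (disjoint_chains (stage antichain_code x)) b" for x b
    using WB BH by (rule trans)
  note chain_stage = prim_rec_stage[OF decidable_chain_code]
    and antichain_stage = prim_rec_stage[OF decidable_antichain_code]
  note le =
    many_one_le_all[where Q = ?B and R = ?H, OF prim_rec_disjoint_chains BH]
    many_one_le_all[where Q = ?H and R = ?B, OF chain_stage HB]
    many_one_le_all[where Q = ?H and R = ?W,
      OF prim_rec_subst[OF prim_rec_stacked_antichains chain_stage] HW]
    many_one_le_all[where Q = ?W and R = ?H,
      OF prim_rec_subst[OF prim_rec_disjoint_chains antichain_stage] WH]
  show ?thesis
    unfolding many_one_equiv_def BddSeq_def FinHeight_def FinWidth_def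
    by (intro conjI le)
qed

end
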